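(* Let $(X,\tau)$ be a metrizable space and let $F=\{a_1,\dots,a_k\}\subseteq X$ be a set of $k$ distinct points, $2\le k<\infty$. Let $s,t\in\mathcal G_F(\tau)$ and let $m=(m_1,\dots,m_k)$ with $m_i=\min\{s_i,t_i\}$. The following are equivalent: (i) $m\in\mathcal G_F(\tau)$; (ii) the topology $\tau_s\cap\tau_t$ is Hausdorff; (iii) $\tau_s$ and $\tau_t$ have a common Hausdorff lower bound, i.e. there is a Hausdorff topology $\lambda$ on $X$ with $\lambda\subseteq\tau_s$ and $\lambda\subseteq\tau_t$; (iv) $\tau_s$ and $\tau_t$ have a meet (greatest lower bound) in $\mathcal L_F^m(\tau)$. When these conditions hold, the meet in $\mathcal L_F^m(\tau)$ is given by $$\tau_s\wedge\tau_t=\tau_m=\tau_s\cap\tau_t.$$ If they fail, every topology on $X$ which is coarser than both $\tau_s$ and $\tau_t$ is non-Hausdorff.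
   Context: $\mathcal L_F^m(\tau)$ is the family of all metrizable topologies $\sigma$ on $X$ with $\sigma\subseteq\tau$ and $\sigma|_{X\setminus F}=\tau|_{X\setminus F}$ (equal subspace topologies on $X\setminus F$), ordered by inclusion. A compatible gauge system at $F$ is a $k$-tuple $s=(s_1,\dots,s_k)$ of $\tau$-continuous functions $s_i:X\to[0,1]$ with $s_i^{-1}(0)=\{a_i\}$ for all $i$ and $\inf_{x\in X}\max\{s_i(x),s_j(x)\}>0$ for all $i\ne j$. $\mathcal G_F(\tau)$ is the class of all compatible gauge systems at $F$. For $s\in\mathcal G_F(\tau)$, $\tau_s$ is the topology on $X$ in which $U\subseteq X$ is open exactly when $U\in\tau$ and, for every $i$ with $a_i\in U$, there is $\varepsilon_i>0$ such that $\{x: s_i(x)<\varepsilon_i\}\subseteq U$. "Coarser" is not necessarily strict. *)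

theory Defs
  imports "HOL-Analysis.Analysis"
begin

text \<open>
  The underlying set of the space is \<open>X = topspace \<tau>\<close>, which need not be the whole type.
  The enumeration of the set \<open>F\<close> and a \<open>k\<close>-tuple of functions on \<open>X\<close> are represented by functions
  on \<^typ>\<open>nat\<close>, of which only the values at the indices \<open>1..k\<close> (and at points of \<open>X\<close>) matter.
\<close>

text \<open>Non-strict inclusion between topologies on the same set.\<close>

definition coarser :: "'a topology \<Rightarrow> 'a topology \<Rightarrow> bool" where
  "coarser \<sigma> \<tau> \<longleftrightarrow> topspace \<sigma> = topspace \<tau> \<and> (\<forall>U. openin \<sigma> U \<longrightarrow> openin \<tau> U)"

definition metrizable_local_coarsenings :: "'a topology \<Rightarrow> 'a set \<Rightarrow> 'a topology set" where
  "metrizable_local_coarsenings \<tau> F =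
     {\<sigma>. metrizable_space \<sigma> \<and> coarser \<sigma> \<tau> \<and>
         subtopology \<sigma> (topspace \<tau> - F) = subtopology \<tau> (topspace \<tau> - F)}"

text \<open>\<open>\<mu>\<close> is the greatest lower bound of \<open>\<sigma>\<close> and \<open>\<rho>\<close> in \<open>L\<close>, ordered by inclusion;
  it is unique because \<^const>\<open>coarser\<close> is antisymmetric.\<close>

definition is_meet_in ::
    "'a topology set \<Rightarrow> 'a topology \<Rightarrow> 'a topology \<Rightarrow> 'a topology \<Rightarrow> bool" where
  "is_meet_in L \<sigma> \<rho> \<mu> \<longleftrightarrow>
     \<mu> \<in> L \<and> coarser \<mu> \<sigma> \<and> coarser \<mu> \<rho> \<and>
     (\<forall>\<nu>\<in>L. coarser \<nu> \<sigma> \<and> coarser \<nu> \<rho> \<longrightarrow> coarser \<nu> \<mu>)"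

definition gauge_systems ::
    "'a topology \<Rightarrow> nat \<Rightarrow> (nat \<Rightarrow> 'a) \<Rightarrow> (nat \<Rightarrow> 'a \<Rightarrow> real) set" where
  "gauge_systems \<tau> k a =
     {s. (\<forall>i\<in>{1..k}. continuous_map \<tau> (top_of_set {0..1}) (s i) \<and>
                     {x \<in> topspace \<tau>. s i x = 0} = {a i}) \<and>
         (\<forall>i\<in>{1..k}. \<forall>j\<in>{1..k}. i \<noteq> j \<longrightarrow>
            (INF x\<in>topspace \<tau>. max (s i x) (s j x)) > 0)}"

definition gauge_topology ::
    "'a topology \<Rightarrow> nat \<Rightarrow> (nat \<Rightarrow> 'a) \<Rightarrow> (nat \<Rightarrow> 'a \<Rightarrow> real) \<Rightarrow> 'a topology" where
  "gauge_topology \<tau> k a s =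
     topology (\<lambda>U. openin \<tau> U \<and>
       (\<forall>i\<in>{1..k}. a i \<in> U \<longrightarrow> (\<exists>\<epsilon>>0. {x \<in> topspace \<tau>. s i x < \<epsilon>} \<subseteq> U)))"

definition inter_topology :: "'a topology \<Rightarrow> 'a topology \<Rightarrow> 'a topology" where
  "inter_topology \<sigma> \<rho> = topology (\<lambda>U. openin \<sigma> U \<and> openin \<rho> U)"

text \<open>The predicates passed to \<^const>\<open>topology\<close> above are topologies, so the definitions
  have the intended open sets.\<close>

lemma openin_gauge_topology:
  "openin (gauge_topology \<tau> k a s) U \<longleftrightarrow>
     openin \<tau> U \<and> (\<forall>i\<in>{1..k}. a i \<in> U \<longrightarrow> (\<exists>\<epsilon>>0. {x \<in> topspace \<tau>. s i x < \<epsilon>} \<subseteq> U))"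
proof -
  let ?N = "\<lambda>i U. \<exists>\<epsilon>>0. {x \<in> topspace \<tau>. s i x < \<epsilon>} \<subseteq> U"
  have int: "?N i (S \<inter> T)" if S: "?N i S" and T: "?N i T" for i S T
  proof -
    obtain d e where "d > 0" "{x \<in> topspace \<tau>. s i x < d} \<subseteq> S"
      and "e > 0" "{x \<in> topspace \<tau>. s i x < e} \<subseteq> T"
      using S T by blast
    then show ?thesis
      by (intro exI[of _ "min d e"]) auto
  qed
  have "istopology (\<lambda>U. openin \<tau> U \<and> (\<forall>i\<in>{1..k}. a i \<in> U \<longrightarrow> ?N i U))"
    unfolding istopology_def
  proof (intro conjI allI impI)
    fix S T
    assume "openin \<tau> S \<and> (\<forall>i\<in>{1..k}. a i \<in> S \<longrightarrow> ?N i S)"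
      and "openin \<tau> T \<and> (\<forall>i\<in>{1..k}. a i \<in> T \<longrightarrow> ?N i T)"
    then show "openin \<tau> (S \<inter> T)" and "\<forall>i\<in>{1..k}. a i \<in> S \<inter> T \<longrightarrow> ?N i (S \<inter> T)"
      using int by (blast intro: openin_Int)+
  next
    fix \<K>
    assume *: "\<forall>K\<in>\<K>. openin \<tau> K \<and> (\<forall>i\<in>{1..k}. a i \<in> K \<longrightarrow> ?N i K)"
    then show "openin \<tau> (\<Union>\<K>)"
      by blast
    show "\<forall>i\<in>{1..k}. a i \<in> \<Union>\<K> \<longrightarrow> ?N i (\<Union>\<K>)"
    proof (intro ballI impI)
      fix i
      assume i: "i \<in> {1..k}" "a i \<in> \<Union>\<K>"
      then obtain K where K: "K \<in> \<K>" "a i \<in> K" by blast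
      then obtain e where "e > 0" "{x \<in> topspace \<tau>. s i x < e} \<subseteq> K"
        using * i by blast
      then show "?N i (\<Union>\<K>)"
        using K by blast
    qed
  qed
  then show ?thesis
    by (simp add: gauge_topology_def topology_inverse')
qed

lemma topspace_gauge_topology [simp]: "topspace (gauge_topology \<tau> k a s) = topspace \<tau>"
proof (rule antisym)
  show "topspace (gauge_topology \<tau> k a s) \<subseteq> topspace \<tau>"
    by (meson openin_gauge_topology openin_subset openin_topspace)
  have "openin (gauge_topology \<tau> k a s) (topspace \<tau>)"
    unfolding openin_gauge_topology by (auto intro: exI[of _ "1::real"])
  then show "topspace \<tau> \<subseteq> topspace (gauge_topology \<tau> k a s)"
    by (rule openin_subset)
qed

lemma openin_inter_topology:
  "openin (inter_topology \<sigma> \<rho>) U \<longleftrightarrow> openin \<sigma> U \<and> openin \<rho> U"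
proof -
  have "istopology (\<lambda>U. openin \<sigma> U \<and> openin \<rho> U)"
    unfolding istopology_def by auto
  then show ?thesis
    by (simp add: inter_topology_def topology_inverse')
qed

end

theory Submission
  imports Defs
begin

text \<open>
  At the point \<open>a i\<close> the sublevel sets of \<open>m i = min (s i) (t i)\<close> are the unions of those of
  \<open>s i\<close> and \<open>t i\<close>.  Hence the intersection of the two gauge topologies is the gauge topology
  of \<open>m\<close>, whether or not \<open>m\<close> is a gauge system (\<open>inter_topology_gauge_topology\<close>), and it is
  the largest topology below both, in any family that contains it.  The theorem is therefore
  a statement about a single topology, and two facts settle it.

  If \<open>m\<close> is a gauge system, its topology is metrizable (\<open>metrizable_gauge_topology\<close>), and it
  agrees with \<open>\<tau>\<close> off \<open>F\<close>, so it is the meet, and it is Hausdorff.  The metric comes from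
  collapsing distances near \<open>F\<close>: a point \<open>x\<close> may jump to \<open>y\<close> at the cost \<open>h x + h y\<close>, where
  \<open>h\<close> vanishes exactly on \<open>F\<close>, so that small gauge values alone make a point close to \<open>F\<close>.  A
  further pseudometric, built from the gauges cut off at a level below which their sublevel
  sets are disjoint, records which point of \<open>F\<close> is meant.

  Conversely, a Hausdorff topology below both gauge topologies separates \<open>a i\<close> from \<open>a j\<close> by
  sets that contain sublevel sets of \<open>m i\<close> and \<open>m j\<close>; that these are disjoint says exactly
  that \<open>max (m i) (m j)\<close> is bounded away from \<open>0\<close> (\<open>gauge_system_if_Hausdorff\<close>).  A meet in
  the family of metrizable topologies is such a Hausdorff topology.
\<close>

section \<open>Gauge systems\<close>

lemma INF_pos_iff_uniform_lower_bound:
  fixes f :: "'a \<Rightarrow> real"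
  assumes "A \<noteq> {}" and "\<And>x. x \<in> A \<Longrightarrow> 0 \<le> f x"
  shows "0 < (INF x\<in>A. f x) \<longleftrightarrow> (\<exists>\<delta>>0. \<forall>x\<in>A. \<delta> \<le> f x)"
proof
  have bdd: "bdd_below (f ` A)"
    using assms by (intro bdd_belowI[of _ 0]) auto
  assume "0 < (INF x\<in>A. f x)"
  then show "\<exists>\<delta>>0. \<forall>x\<in>A. \<delta> \<le> f x"
    using cINF_lower[OF bdd] by blast
next
  assume "\<exists>\<delta>>0. \<forall>x\<in>A. \<delta> \<le> f x"
  then obtain \<delta> where "\<delta> > 0" "\<forall>x\<in>A. \<delta> \<le> f x"
    by blast
  then show "0 < (INF x\<in>A. f x)"
    using cINF_greatest[of A \<delta> f] assms(1) by fastforce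
qed

lemma gauge_systems_bounds:
  assumes "s \<in> gauge_systems \<tau> k a" "i \<in> {1..k}" "x \<in> topspace \<tau>"
  shows "0 \<le> s i x" "s i x \<le> 1"
  using assms by (force simp: gauge_systems_def continuous_map_in_subtopology)+

lemma gauge_systems_eq_0_iff:
  assumes "s \<in> gauge_systems \<tau> k a" "i \<in> {1..k}" "x \<in> topspace \<tau>"
  shows "s i x = 0 \<longleftrightarrow> x = a i"
  using assms by (auto simp: gauge_systems_def)

lemma gauge_systems_continuous_map:
  assumes "s \<in> gauge_systems \<tau> k a" "i \<in> {1..k}"
  shows "continuous_map \<tau> euclideanreal (s i)"
  using assms by (auto simp: gauge_systems_def continuous_map_in_subtopology)

text \<open>
  There are only finitely many pairs of indices, so one level \<open>\<delta>\<close> serves for all of them: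
  this is the form in which the positivity of the infima is used.
\<close>

lemma gauge_system_separation_level:
  assumes s: "s \<in> gauge_systems \<tau> k a" and a: "a ` {1..k} \<subseteq> topspace \<tau>"
  obtains \<delta> where "\<delta> > 0"
    and "\<And>i j x. \<lbrakk>i \<in> {1..k}; j \<in> {1..k}; i \<noteq> j; x \<in> topspace \<tau>; s i x < \<delta>\<rbrakk> \<Longrightarrow> \<delta> \<le> s j x"
proof -
  define P where "P = {(i, j). i \<in> {1..k} \<and> j \<in> {1..k} \<and> i \<noteq> j}"
  have "finite P"
    by (rule finite_subset[of _ "{1..k} \<times> {1..k}"]) (auto simp: P_def)
  have "\<exists>\<delta>>0. \<forall>x\<in>topspace \<tau>. \<delta> \<le> max (s (fst p) x) (s (snd p) x)" if "p \<in> P" for p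
  proof -
    obtain i j where p: "p = (i, j)" "i \<in> {1..k}" "j \<in> {1..k}" "i \<noteq> j"
      using \<open>p \<in> P\<close> by (auto simp: P_def)
    have "0 \<le> max (s i x) (s j x)" if "x \<in> topspace \<tau>" for x
      using gauge_systems_bounds(1)[OF s p(2) that] by simp
    moreover have "0 < (INF x\<in>topspace \<tau>. max (s i x) (s j x))"
      using s p by (auto simp: gauge_systems_def)
    moreover have "topspace \<tau> \<noteq> {}"
      using a p by auto
    ultimately show ?thesis
      using INF_pos_iff_uniform_lower_bound[of "topspace \<tau>" "\<lambda>x. max (s i x) (s j x)"] p by simp
  qed
  then obtain f where f: "\<And>p. p \<in> P \<Longrightarrow>
      f p > 0 \<and> (\<forall>x\<in>topspace \<tau>. f p \<le> max (s (fst p) x) (s (snd p) x))"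
    by metis
  define \<delta> :: real where "\<delta> = Min (insert 1 (f ` P))"
  have "\<delta> > 0"
    using f \<open>finite P\<close> by (simp add: \<delta>_def)
  moreover have "\<delta> \<le> s j x"
    if "i \<in> {1..k}" "j \<in> {1..k}" "i \<noteq> j" "x \<in> topspace \<tau>" "s i x < \<delta>" for i j x
  proof -
    have p: "(i, j) \<in> P"
      using that by (auto simp: P_def)
    then have "\<delta> \<le> f (i, j)"
      using \<open>finite P\<close> by (auto simp: \<delta>_def intro!: Min_le)
    also have "\<dots> \<le> max (s i x) (s j x)"
      using f[OF p] that by auto
    finally show ?thesis
      using that by simp
  qed
  ultimately show ?thesis
    using that by blast
qed

text \<open>The minimum inherits everything except the separation of the gauges from each other.\<close>

lemma min_gauge_system_iff:
  assumes s: "s \<in> gauge_systems \<tau> k a" and t: "t \<in> gauge_systems \<tau> k a"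
    and a: "a ` {1..k} \<subseteq> topspace \<tau>"
  shows "(\<lambda>i x. min (s i x) (t i x)) \<in> gauge_systems \<tau> k a \<longleftrightarrow>
    (\<forall>i\<in>{1..k}. \<forall>j\<in>{1..k}. i \<noteq> j \<longrightarrow>
      (\<exists>\<delta>>0. \<forall>x\<in>topspace \<tau>. \<delta> \<le> max (min (s i x) (t i x)) (min (s j x) (t j x))))"
proof -
  note bounds = gauge_systems_bounds[OF s] gauge_systems_bounds[OF t]
  let ?m = "\<lambda>i x. min (s i x) (t i x)"
  have "continuous_map \<tau> (top_of_set {0..1}) (?m i)" if "i \<in> {1..k}" for i
    using bounds that
    by (auto simp: continuous_map_in_subtopology min_le_iff_disj
        intro!: continuous_map_real_min gauge_systems_continuous_map[OF s]
          gauge_systems_continuous_map[OF t])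
  moreover have "{x \<in> topspace \<tau>. ?m i x = 0} = {a i}" if "i \<in> {1..k}" for i
  proof -
    have "?m i x = 0 \<longleftrightarrow> x = a i" if "x \<in> topspace \<tau>" for x
      using bounds[OF \<open>i \<in> {1..k}\<close> that] gauge_systems_eq_0_iff[OF s \<open>i \<in> {1..k}\<close> that]
        gauge_systems_eq_0_iff[OF t \<open>i \<in> {1..k}\<close> that]
      by (auto simp: min_def)
    moreover have "a i \<in> topspace \<tau>"
      using a that by blast
    ultimately show ?thesis
      by blast
  qed
  moreover have "0 < (INF x\<in>topspace \<tau>. max (?m i x) (?m j x)) \<longleftrightarrow>
      (\<exists>\<delta>>0. \<forall>x\<in>topspace \<tau>. \<delta> \<le> max (?m i x) (?m j x))"
    if "i \<in> {1..k}" "j \<in> {1..k}" for i j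
    using a that bounds
    by (intro INF_pos_iff_uniform_lower_bound) (auto simp: le_max_iff_disj)
  ultimately show ?thesis
    by (simp add: gauge_systems_def)
qed

section \<open>Gauge topologies\<close>

text \<open>
  A set contains a sublevel set of the minimum if and only if it contains one of each gauge,
  as the smaller of the two levels can be used.
\<close>

lemma inter_topology_gauge_topology:
  "inter_topology (gauge_topology \<tau> k a s) (gauge_topology \<tau> k a t) =
     gauge_topology \<tau> k a (\<lambda>i x. min (s i x) (t i x))"
proof -
  have "(\<exists>\<epsilon>>0. {x \<in> topspace \<tau>. min (s i x) (t i x) < \<epsilon>} \<subseteq> U) \<longleftrightarrow>
      (\<exists>\<epsilon>>0. {x \<in> topspace \<tau>. s i x < \<epsilon>} \<subseteq> U) \<and> (\<exists>\<epsilon>>0. {x \<in> topspace \<tau>. t i x < \<epsilon>} \<subseteq> U)"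
    (is "?M \<longleftrightarrow> ?S \<and> ?T") for i U
  proof
    assume ?M
    then show "?S \<and> ?T"
      by (auto simp: min_less_iff_disj)
  next
    assume "?S \<and> ?T"
    then obtain \<epsilon> \<epsilon>' where "\<epsilon> > 0" "{x \<in> topspace \<tau>. s i x < \<epsilon>} \<subseteq> U"
      and "\<epsilon>' > 0" "{x \<in> topspace \<tau>. t i x < \<epsilon>'} \<subseteq> U"
      by blast
    then show ?M
      by (intro exI[of _ "min \<epsilon> \<epsilon>'"]) (auto simp: min_def split: if_splits)
  qed
  then show ?thesis
    by (auto simp: topology_eq openin_inter_topology openin_gauge_topology)
qed

lemma coarser_gauge_topology: "coarser (gauge_topology \<tau> k a s) \<tau>"
  by (simp add: coarser_def openin_gauge_topology)

text \<open>Away from the points \<open>a i\<close> the condition on neighbourhoods is void.\<close>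

lemma subtopology_gauge_topology:
  assumes "t1_space \<tau>" and a: "a ` {1..k} \<subseteq> topspace \<tau>"
  shows "subtopology (gauge_topology \<tau> k a s) (topspace \<tau> - a ` {1..k}) =
    subtopology \<tau> (topspace \<tau> - a ` {1..k})"
proof -
  let ?Y = "topspace \<tau> - a ` {1..k}"
  have "openin (gauge_topology \<tau> k a s) (V \<inter> ?Y)" if "openin \<tau> V" for V
  proof -
    have "V \<inter> ?Y = V - a ` {1..k}"
      using openin_subset[OF that] by auto
    moreover have "openin \<tau> (V - a ` {1..k})"
    proof (rule openin_diff[OF that])
      have "closedin \<tau> (topspace \<tau> \<inter> a ` {1..k})"
        using assms by (simp add: t1_space_closedin_finite)
      then show "closedin \<tau> (a ` {1..k})"
        using a by (simp add: Int_absorb1)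
    qed
    ultimately show ?thesis
      by (auto simp: openin_gauge_topology)
  qed
  then have "\<exists>W. openin (gauge_topology \<tau> k a s) W \<and> V \<inter> ?Y = W \<inter> ?Y"
    if "openin \<tau> V" for V
    using that by (intro exI[of _ "V \<inter> ?Y"]) auto
  then show ?thesis
    unfolding topology_eq openin_subtopology
    by (metis openin_gauge_topology)
qed

section \<open>Metrizability\<close>

text \<open>
  The metric that lets a point \<open>x\<close> reach \<open>y\<close> at the cost \<open>h x + h y\<close>, through the zero set of
  \<open>h\<close>.  In the triangle inequality a path that combines an ordinary step with a jump is
  estimated by a single jump; the change of \<open>h\<close> along the ordinary step has to be paid for by
  its length, which is why \<open>E\<close> is added to \<open>d\<close>.  The outer \<open>E\<close> keeps different zeros of \<open>h\<close>
  apart.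
\<close>

lemma Metric_space_collapse:
  fixes E :: "'a \<Rightarrow> 'a \<Rightarrow> real" and h :: "'a \<Rightarrow> real"
  assumes "Metric_space M d"
    and h_nonneg: "\<And>x. 0 \<le> h x"
    and E_nonneg: "\<And>x y. 0 \<le> E x y"
    and E_commute: "\<And>x y. E x y = E y x"
    and E_triangle: "\<And>x y z. E x z \<le> E x y + E y z"
    and E_refl: "\<And>x. E x x = 0"
    and h_Lipschitz: "\<And>x y. \<lbrakk>x \<in> M; y \<in> M\<rbrakk> \<Longrightarrow> h x \<le> h y + E x y"
    and E_pos: "\<And>x y. \<lbrakk>x \<in> M; y \<in> M; h x = 0; h y = 0; x \<noteq> y\<rbrakk> \<Longrightarrow> 0 < E x y"
  shows "Metric_space M (\<lambda>x y. min (d x y + E x y) (h x + h y) + E x y)"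
proof -
  interpret Metric_space M d by fact
  show ?thesis
  proof
    show "0 \<le> min (d x y + E x y) (h x + h y) + E x y" for x y
      using h_nonneg[of x] h_nonneg[of y] E_nonneg[of x y] nonneg[of x y] by linarith
    show "min (d x y + E x y) (h x + h y) + E x y = min (d y x + E y x) (h y + h x) + E y x" for x y
      by (simp add: E_commute[of x y] commute[of x y] add.commute)
    show "min (d x y + E x y) (h x + h y) + E x y = 0 \<longleftrightarrow> x = y" if "x \<in> M" "y \<in> M" for x y
      using h_nonneg[of x] h_nonneg[of y] E_nonneg[of x y] nonneg[of x y] that
        E_pos[of x y] E_refl[of x] zero[of x y]
      by (smt (verit))
    show "min (d x z + E x z) (h x + h z) + E x z \<le>
        min (d x y + E x y) (h x + h y) + E x y + (min (d y z + E y z) (h y + h z) + E y z)"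
      if "x \<in> M" "y \<in> M" "z \<in> M" for x y z
      using E_triangle[of x z y] triangle[OF that] h_nonneg[of y] h_Lipschitz[of x y]
        h_Lipschitz[of z y] E_commute[of z y] nonneg[of x y] nonneg[of y z] that
      by linarith
  qed
qed

text \<open>
  The gauges \<open>s i\<close> themselves need not be continuous for the gauge topology, since \<open>s i\<close> may
  oscillate where another \<open>s j\<close> is small.  Cut off at the separation level \<open>\<delta>\<close> they are
  continuous: where \<open>s j < \<delta>\<close>, every other cut-off gauge is constantly \<open>\<delta>\<close>.
  Their product \<open>h\<close> vanishes exactly on the points \<open>a i\<close>, and it is Lipschitz for the sum \<open>E\<close> of
  their differences because they are bounded by \<open>1\<close>.
\<close>

theorem metrizable_gauge_topology:
  assumes \<tau>: "metrizable_space \<tau>" and s: "s \<in> gauge_systems \<tau> k a"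
    and a: "a ` {1..k} \<subseteq> topspace \<tau>"
  shows "metrizable_space (gauge_topology \<tau> k a s)"
proof -
  obtain M d where "Metric_space M d" and \<tau>_eq: "\<tau> = Metric_space.mtopology M d"
    using \<tau> by (auto simp: metrizable_space_def)
  interpret Metric_space M d by fact
  have M: "topspace \<tau> = M"
    by (simp add: \<tau>_eq)
  obtain \<delta> where "\<delta> > 0" and
    sep: "\<And>i j x. \<lbrakk>i \<in> {1..k}; j \<in> {1..k}; i \<noteq> j; x \<in> M; s i x < \<delta>\<rbrakk> \<Longrightarrow> \<delta> \<le> s j x"
    using gauge_system_separation_level[OF s a] unfolding M by blast
  note s_bounds = gauge_systems_bounds[OF s, unfolded M]
  note s_eq_0 = gauge_systems_eq_0_iff[OF s, unfolded M]
  \<comment> \<open>The absolute value matters only outside the space, where the metric must be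
    nonnegative, too.\<close>
  define e where "e i x = min \<delta> \<bar>s i x\<bar>" for i x
  define E where "E x y = (\<Sum>i\<in>{1..k}. \<bar>e i x - e i y\<bar>)" for x y
  define h where "h x = (\<Prod>i\<in>{1..k}. e i x)" for x
  define D where "D x y = min (d x y + E x y) (h x + h y) + E x y" for x y
  have e_nonneg: "0 \<le> e i x" for i x
    using \<open>\<delta> > 0\<close> by (simp add: e_def)
  have e_le_1: "e i x \<le> 1" if "i \<in> {1..k}" "x \<in> M" for i x
    using s_bounds[OF that] by (simp add: e_def)
  have e_less: "s i x < r" if "i \<in> {1..k}" "x \<in> M" "e i x < r" "r \<le> \<delta>" for i x r
    using that s_bounds[OF that(1,2)] by (simp add: e_def min_less_iff_disj)
  have e_eq_0: "e i x = 0 \<longleftrightarrow> x = a i" if "i \<in> {1..k}" "x \<in> M" for i x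
    using \<open>\<delta> > 0\<close> s_eq_0[OF that] by (auto simp: e_def min_def)
  have a_M: "a i \<in> M" if "i \<in> {1..k}" for i
    using a that M by auto
  have h_eq_0: "h x = 0 \<longleftrightarrow> x \<in> a ` {1..k}" if "x \<in> M" for x
    using e_eq_0[OF _ that] by (auto simp: h_def)
  have h_nonneg: "0 \<le> h x" for x
    by (simp add: h_def prod_nonneg e_nonneg)
  have h_le: "h x \<le> e i x" if "i \<in> {1..k}" "x \<in> M" for i x
  proof -
    have "h x = e i x * (\<Prod>j\<in>{1..k} - {i}. e j x)"
      using that by (simp add: h_def prod.remove)
    also have "\<dots> \<le> e i x * 1"
      using that by (intro mult_left_mono prod_le_1) (auto simp: e_nonneg e_le_1)
    finally show ?thesis by simp
  qed
  have E_ge: "\<bar>e i x - e i y\<bar> \<le> E x y" if "i \<in> {1..k}" for i x y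
    unfolding E_def using that by (intro member_le_sum) auto
  have E_nonneg: "0 \<le> E x y" for x y
    by (simp add: E_def sum_nonneg)
  have h_Lipschitz: "h x \<le> h y + E x y" if "x \<in> M" "y \<in> M" for x y
  proof -
    have "norm (h x - h y) \<le> E x y"
      using norm_prod_diff[of "{1..k}" "\<lambda>i. e i x" "\<lambda>i. e i y"] that e_nonneg e_le_1
      by (simp add: h_def E_def)
    then show ?thesis by simp
  qed
  have E_pos: "0 < E x y" if xy: "x \<in> M" "y \<in> M" "h x = 0" "h y = 0" "x \<noteq> y" for x y
  proof -
    obtain i where i: "i \<in> {1..k}" "x = a i"
      using xy h_eq_0 by auto
    then have "e i x = 0" "e i y \<noteq> 0"
      using xy e_eq_0 by auto
    then show ?thesis
      using E_ge[OF i(1), of x y] by simp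
  qed
  have "Metric_space M D"
    unfolding D_def
  proof (rule Metric_space_collapse)
    show "E x z \<le> E x y + E y z" for x y z
      unfolding E_def sum.distrib[symmetric] by (intro sum_mono) linarith
    show "E x y = E y x" "E x x = 0" for x y
      by (simp_all add: E_def abs_minus_commute)
  qed (fact \<open>Metric_space M d\<close> | fact E_nonneg | fact h_nonneg | fact h_Lipschitz | fact E_pos)+
  then interpret D: Metric_space M D .
  have "openin D.mtopology U \<longleftrightarrow> openin (gauge_topology \<tau> k a s) U" for U
  proof
    assume U: "openin D.mtopology U"
    have "openin \<tau> U"
    proof (subst openin_subopen, intro ballI)
      fix x assume x: "x \<in> U"
      then obtain r where "r > 0" and r: "D.mball x r \<subseteq> U" and "x \<in> M"
        using U unfolding D.openin_mtopology by blast
      have "continuous_map \<tau> euclideanreal (E x)"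
        unfolding E_def e_def
        by (intro continuous_map_sum continuous_map_real_abs continuous_map_diff
            continuous_map_real_min gauge_systems_continuous_map[OF s]) auto
      then have "openin \<tau> {y \<in> topspace \<tau>. E x y \<in> {..<r / 3}}"
        by (rule openin_continuous_map_preimage) simp
      then have "openin \<tau> (mball x (r / 3) \<inter> {y \<in> topspace \<tau>. E x y \<in> {..<r / 3}})"
        by (simp add: \<tau>_eq openin_Int)
      moreover have "x \<in> mball x (r / 3) \<inter> {y \<in> topspace \<tau>. E x y \<in> {..<r / 3}}"
        using \<open>r > 0\<close> \<open>x \<in> M\<close> by (simp add: M E_def)
      moreover have "mball x (r / 3) \<inter> {y \<in> topspace \<tau>. E x y \<in> {..<r / 3}} \<subseteq> D.mball x r"
        by (auto simp: D_def)
      ultimately show "\<exists>T. openin \<tau> T \<and> x \<in> T \<and> T \<subseteq> U"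
        using r by blast
    qed
    moreover have "\<exists>\<epsilon>>0. {x \<in> topspace \<tau>. s i x < \<epsilon>} \<subseteq> U" if i: "i \<in> {1..k}" and "a i \<in> U" for i
    proof -
      obtain r where "r > 0" and r: "D.mball (a i) r \<subseteq> U"
        using U \<open>a i \<in> U\<close> unfolding D.openin_mtopology by blast
      have "D (a i) x < r" if "x \<in> M" and x: "s i x < min \<delta> (r / 2)" for x
      proof -
        have "e j (a i) = \<delta> \<and> e j x = \<delta>" if "j \<in> {1..k} - {i}" for j
          using sep[of i j x] sep[of i j "a i"] s_eq_0[OF i a_M[OF i]] that x i \<open>x \<in> M\<close>
            a_M[OF i] \<open>\<delta> > 0\<close>
          by (auto simp: e_def)
        then have "E (a i) x = \<bar>e i (a i) - e i x\<bar>"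
          using i by (simp add: E_def sum.remove[where x = i])
        also have "\<dots> = e i x"
          using e_eq_0[OF i a_M[OF i]] e_nonneg[of i x] by simp
        finally have "E (a i) x = e i x" .
        moreover have "h (a i) = 0"
          using h_eq_0[OF a_M[OF i]] i by simp
        moreover have "e i x < r / 2"
          using x s_bounds[OF i \<open>x \<in> M\<close>] by (simp add: e_def)
        ultimately show ?thesis
          using h_le[OF i \<open>x \<in> M\<close>] by (simp add: D_def min_def)
      qed
      then have "{x \<in> topspace \<tau>. s i x < min \<delta> (r / 2)} \<subseteq> U"
        using r a_M[OF i] M by (auto simp: subset_iff)
      then show ?thesis
        using \<open>\<delta> > 0\<close> \<open>r > 0\<close> by (intro exI[of _ "min \<delta> (r / 2)"]) auto
    qed
    ultimately show "openin (gauge_topology \<tau> k a s) U"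
      by (simp add: openin_gauge_topology)
  next
    assume "openin (gauge_topology \<tau> k a s) U"
    then have U: "openin \<tau> U"
      and nbhd: "\<And>i. \<lbrakk>i \<in> {1..k}; a i \<in> U\<rbrakk> \<Longrightarrow> \<exists>\<epsilon>>0. {x \<in> topspace \<tau>. s i x < \<epsilon>} \<subseteq> U"
      by (auto simp: openin_gauge_topology)
    have "\<exists>r>0. D.mball x r \<subseteq> U" if "x \<in> U" for x
    proof (cases "x \<in> a ` {1..k}")
      case True
      then obtain i where i: "i \<in> {1..k}" "x = a i"
        by blast
      then obtain \<epsilon> where "\<epsilon> > 0" and \<epsilon>: "{x \<in> topspace \<tau>. s i x < \<epsilon>} \<subseteq> U"
        using nbhd \<open>x \<in> U\<close> by blast
      have "y \<in> U" if y: "y \<in> D.mball x (min \<epsilon> \<delta>)" for y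
      proof -
        have "x \<in> M" "y \<in> M"
          using y by auto
        have "e i x = 0"
          using e_eq_0[OF i(1) \<open>x \<in> M\<close>] i by simp
        then have "e i y \<le> E x y"
          using E_ge[OF i(1), of x y] by simp
        also have "\<dots> \<le> D x y"
          using E_nonneg[of x y] h_nonneg[of x] h_nonneg[of y] nonneg[of x y]
          by (simp add: D_def)
        also have "\<dots> < min \<epsilon> \<delta>"
          using y by simp
        finally have "s i y < min \<epsilon> \<delta>"
          using e_less[OF i(1) \<open>y \<in> M\<close>, of "min \<epsilon> \<delta>"] by simp
        then show ?thesis
          using \<epsilon> \<open>y \<in> M\<close> M by auto
      qed
      then show ?thesis
        using \<open>\<epsilon> > 0\<close> \<open>\<delta> > 0\<close> by (intro exI[of _ "min \<epsilon> \<delta>"]) auto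
    next
      case False
      have "x \<in> M"
        using \<open>x \<in> U\<close> openin_subset[OF U] M by auto
      \<comment> \<open>A jump costs at least \<open>h x > 0\<close>, so a shorter distance is an ordinary one.\<close>
      then have "h x > 0"
        using h_eq_0 h_nonneg[of x] False by fastforce
      obtain r where "r > 0" and r: "mball x r \<subseteq> U"
        using U \<open>x \<in> U\<close> unfolding \<tau>_eq openin_mtopology by blast
      have "d x y < r" if "D x y < min r (h x)" for y
        using that E_nonneg[of x y] h_nonneg[of y] by (auto simp: D_def min_def split: if_splits)
      then have "D.mball x (min r (h x)) \<subseteq> mball x r"
        by auto
      then show ?thesis
        using r \<open>r > 0\<close> \<open>h x > 0\<close> by (intro exI[of _ "min r (h x)"]) auto
    qed
    then show "openin D.mtopology U"
      using openin_subset[OF U] M by (simp add: D.openin_mtopology)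
  qed
  then have "gauge_topology \<tau> k a s = D.mtopology"
    by (simp add: topology_eq)
  then show ?thesis
    by (simp add: D.metrizable_space_mtopology)
qed

section \<open>Hausdorff lower bounds and meets\<close>

text \<open>
  A set open for both gauge topologies that contains \<open>a i\<close> contains a sublevel set of the
  minimum.  So if \<open>\<epsilon>\<close> and \<open>\<epsilon>'\<close> are levels inside disjoint neighbourhoods of \<open>a i\<close> and \<open>a j\<close>, at
  no point can both minima lie below \<open>min \<epsilon> \<epsilon>'\<close>.
\<close>

lemma gauge_system_if_Hausdorff:
  assumes s: "s \<in> gauge_systems \<tau> k a" and t: "t \<in> gauge_systems \<tau> k a"
    and inj: "inj_on a {1..k}" and a: "a ` {1..k} \<subseteq> topspace \<tau>"
    and \<nu>: "Hausdorff_space \<nu>"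
    and \<nu>_s: "coarser \<nu> (gauge_topology \<tau> k a s)" and \<nu>_t: "coarser \<nu> (gauge_topology \<tau> k a t)"
  shows "(\<lambda>i x. min (s i x) (t i x)) \<in> gauge_systems \<tau> k a"
  unfolding min_gauge_system_iff[OF s t a]
proof (intro ballI impI)
  fix i j assume ij: "i \<in> {1..k}" "j \<in> {1..k}" "i \<noteq> j"
  let ?m = "\<lambda>i x. min (s i x) (t i x)"
  have nbhd: "\<exists>\<epsilon>>0. {x \<in> topspace \<tau>. ?m l x < \<epsilon>} \<subseteq> W"
    if "openin \<nu> W" "l \<in> {1..k}" "a l \<in> W" for l W
  proof -
    have "openin (inter_topology (gauge_topology \<tau> k a s) (gauge_topology \<tau> k a t)) W"
      using \<nu>_s \<nu>_t \<open>openin \<nu> W\<close> by (simp add: coarser_def openin_inter_topology)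
    then show ?thesis
      using that by (simp add: inter_topology_gauge_topology openin_gauge_topology)
  qed
  have "a i \<noteq> a j"
    using inj ij by (auto dest: inj_onD)
  moreover have "a i \<in> topspace \<nu>" "a j \<in> topspace \<nu>"
    using \<nu>_s a ij by (auto simp: coarser_def)
  ultimately obtain U V where "openin \<nu> U" "openin \<nu> V" "a i \<in> U" "a j \<in> V" "disjnt U V"
    using \<nu> unfolding Hausdorff_space_def by blast
  then obtain \<epsilon> \<epsilon>' where \<epsilon>: "\<epsilon> > 0" "{x \<in> topspace \<tau>. ?m i x < \<epsilon>} \<subseteq> U"
    and \<epsilon>': "\<epsilon>' > 0" "{x \<in> topspace \<tau>. ?m j x < \<epsilon>'} \<subseteq> V"
    using nbhd ij by meson
  have "min \<epsilon> \<epsilon>' \<le> max (?m i x) (?m j x)" if "x \<in> topspace \<tau>" for x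
  proof (rule ccontr)
    assume "\<not> ?thesis"
    then have "?m i x < \<epsilon>" "?m j x < \<epsilon>'"
      by linarith+
    then show False
      using \<epsilon> \<epsilon>' that \<open>disjnt U V\<close> by (auto simp: disjnt_def)
  qed
  then show "\<exists>\<delta>>0. \<forall>x\<in>topspace \<tau>. \<delta> \<le> max (?m i x) (?m j x)"
    using \<epsilon> \<epsilon>' by (intro exI[of _ "min \<epsilon> \<epsilon>'"]) auto
qed

lemma topspace_inter_topology:
  assumes "topspace \<sigma> = topspace \<rho>"
  shows "topspace (inter_topology \<sigma> \<rho>) = topspace \<sigma>"
  using assms by (metis openin_inter_topology openin_subset openin_topspace subset_antisym)

lemma is_meet_in_inter_topology:
  assumes "inter_topology \<sigma> \<rho> \<in> L" and "topspace \<sigma> = topspace \<rho>"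
  shows "is_meet_in L \<sigma> \<rho> (inter_topology \<sigma> \<rho>)"
proof -
  show ?thesis
    using assms
    by (auto simp: is_meet_in_def coarser_def openin_inter_topology topspace_inter_topology)
qed

theorem theorem5p4:
  fixes \<tau> :: "'a topology" and k :: nat and a :: "nat \<Rightarrow> 'a" and F :: "'a set"
    and s t m :: "nat \<Rightarrow> 'a \<Rightarrow> real" and \<tau>\<^sub>s \<tau>\<^sub>t \<tau>\<^sub>m :: "'a topology"
  assumes "metrizable_space \<tau>"
    and "k \<ge> 2"
    and "inj_on a {1..k}"
    and "F = a ` {1..k}"
    and "F \<subseteq> topspace \<tau>"
    and "s \<in> gauge_systems \<tau> k a"
    and "t \<in> gauge_systems \<tau> k a"
    and "m = (\<lambda>i x. min (s i x) (t i x))"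
    and "\<tau>\<^sub>s = gauge_topology \<tau> k a s"
    and "\<tau>\<^sub>t = gauge_topology \<tau> k a t"
    and "\<tau>\<^sub>m = gauge_topology \<tau> k a m"
  shows "(m \<in> gauge_systems \<tau> k a \<longleftrightarrow> Hausdorff_space (inter_topology \<tau>\<^sub>s \<tau>\<^sub>t))
    \<and> (Hausdorff_space (inter_topology \<tau>\<^sub>s \<tau>\<^sub>t) \<longleftrightarrow>
         (\<exists>\<nu>. Hausdorff_space \<nu> \<and> coarser \<nu> \<tau>\<^sub>s \<and> coarser \<nu> \<tau>\<^sub>t))
    \<and> ((\<exists>\<nu>. Hausdorff_space \<nu> \<and> coarser \<nu> \<tau>\<^sub>s \<and> coarser \<nu> \<tau>\<^sub>t) \<longleftrightarrow>
         (\<exists>\<mu>. is_meet_in (metrizable_local_coarsenings \<tau> F) \<tau>\<^sub>s \<tau>\<^sub>t \<mu>))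
    \<and> (m \<in> gauge_systems \<tau> k a \<longrightarrow>
         is_meet_in (metrizable_local_coarsenings \<tau> F) \<tau>\<^sub>s \<tau>\<^sub>t \<tau>\<^sub>m \<and>
         \<tau>\<^sub>m = inter_topology \<tau>\<^sub>s \<tau>\<^sub>t)
    \<and> (m \<notin> gauge_systems \<tau> k a \<longrightarrow>
         (\<forall>\<nu>. coarser \<nu> \<tau>\<^sub>s \<and> coarser \<nu> \<tau>\<^sub>t \<longrightarrow> \<not> Hausdorff_space \<nu>))"
proof -
  note \<tau> = assms(1) and inj = assms(3) and F = assms(4) and s = assms(6) and t = assms(7)
    and m = assms(8) and defs = assms(9-11)
  have a: "a ` {1..k} \<subseteq> topspace \<tau>"
    using assms(5) F by simp
  have inter: "\<tau>\<^sub>m = inter_topology \<tau>\<^sub>s \<tau>\<^sub>t"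
    by (simp add: defs m inter_topology_gauge_topology)
  have below: "coarser \<tau>\<^sub>m \<tau>\<^sub>s" "coarser \<tau>\<^sub>m \<tau>\<^sub>t"
    using inter
    by (simp_all add: coarser_def openin_inter_topology topspace_inter_topology defs)
  have member: "\<tau>\<^sub>m \<in> metrizable_local_coarsenings \<tau> F" if "m \<in> gauge_systems \<tau> k a"
    using metrizable_gauge_topology[OF \<tau> that a] coarser_gauge_topology[of \<tau> k a m]
      subtopology_gauge_topology[OF _ a, of m] \<tau>
    by (simp add: metrizable_local_coarsenings_def defs F Hausdorff_imp_t1_space
        metrizable_imp_Hausdorff_space)
  have meet: "is_meet_in (metrizable_local_coarsenings \<tau> F) \<tau>\<^sub>s \<tau>\<^sub>t \<tau>\<^sub>m"
    if "m \<in> gauge_systems \<tau> k a"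
    using is_meet_in_inter_topology[of \<tau>\<^sub>s \<tau>\<^sub>t] member[OF that] inter by (simp add: defs)
  have Hausdorff_bound: "\<exists>\<nu>. Hausdorff_space \<nu> \<and> coarser \<nu> \<tau>\<^sub>s \<and> coarser \<nu> \<tau>\<^sub>t"
    if "is_meet_in (metrizable_local_coarsenings \<tau> F) \<tau>\<^sub>s \<tau>\<^sub>t \<mu>" for \<mu>
    using that metrizable_imp_Hausdorff_space
    by (auto simp: is_meet_in_def metrizable_local_coarsenings_def)
  have gauge: "m \<in> gauge_systems \<tau> k a"
    if "Hausdorff_space \<nu>" "coarser \<nu> \<tau>\<^sub>s" "coarser \<nu> \<tau>\<^sub>t" for \<nu>
    using gauge_system_if_Hausdorff[OF s t inj a] that by (simp add: defs m)
  have "Hausdorff_space \<tau>\<^sub>m" if "m \<in> gauge_systems \<tau> k a"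
    using member[OF that] metrizable_imp_Hausdorff_space
    by (auto simp: metrizable_local_coarsenings_def)
  then show ?thesis
    unfolding inter[symmetric] using below meet Hausdorff_bound gauge by blast
qed

end
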